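(* Assume the dewetting condition $$\begin{cases} c_S<6c_F & \text{if } q\neq1,\\ c_S<4c_F & \text{if } q=1.\end{cases}$$ For every $n\in\mathbb{N}$ let $\widehat D_n\in\mathcal{C}_n$ be a minimizer of $V_n$ among all crystalline configurations in $\mathcal{C}_n$, i.e., $V_n(\widehat D_n)=\min_{D_n\in\mathcal{C}_n}V_n(D_n)$, and select a connected component $\widehat D_{n,1}\subset\widehat D_n$ with largest cardinality. Then $$\lim_{n\to\infty}\mu_{\widehat D_n}\big(n^{-1/2}\widehat D_{n,1}\big)=\lim_{n\to\infty}\frac{\#\widehat D_{n,1}}{n}=1,$$ where $\mu_{\widehat D_n}$ is the empirical measure associated to $\widehat D_n$.
   Context: Lattices. Let $e_S:=q/p$ with $p,q\in\mathbb{N}$ without common factors, $S:=\mathbb{R}\times\{r\in\mathbb{R}: r<0\}$, $\boldsymbol t_1:=(1,0)$, $\boldsymbol t_2:=\frac12(1,\sqrt3)$, $\boldsymbol t_3:=(0,1)$, $x_F:=(0,e_S)$. The substrate lattice $\mathcal{L}_S\subset\overline S$ is a fixed lattice, fully occupied by substrate atoms, with $\partial\mathcal{L}_S:=\mathcal{L}_S\cap(\mathbb{R}\times\{0\})=\{(ke_S,0):k\in\mathbb{Z}\}$. The film lattice is $\mathcal{L}_F:=\{x_F+k_1\boldsymbol t_1+k_2\boldsymbol t_2: k_1\in\mathbb{Z},\,k_2\in\mathbb{N}\cup\{0\}\}$, with $\partial\mathcal{L}_F:=\{x_F+k_1\boldsymbol t_1:k_1\in\mathbb{Z}\}$ and $\partial\mathcal{L}_{FS}:=\partial\mathcal{L}_F\cap(\partial\mathcal{L}_S+e_S\boldsymbol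 t_3)$. Crystalline configurations with $n$ atoms: $\mathcal{C}_n:=\{D\subset\mathcal{L}_F:\#D=n\}$. Energy. Let $c_F,c_S>0$ and $e_F:=1$. For $\alpha\in\{F,S\}$ let $v_{F\alpha}(r):=+\infty$ if $r<e_\alpha$, $v_{F\alpha}(r):=-c_\alpha$ if $r=e_\alpha$, and $v_{F\alpha}(r):=0$ if $r>e_\alpha$. Let $v^1(x):=\sum_{s\in\mathcal{L}_S}v_{FS}(|x-s|)$; for $x\in\mathcal{L}_F$ one has $v^1(x)=-c_S$ if $x\in\partial\mathcal{L}_{FS}$ and $v^1(x)=0$ otherwise. For $D_n=\{x_1,\dots,x_n\}\in\mathcal{C}_n$, $$V_n(D_n):=\sum_{i\ne j}v_{FF}(|x_i-x_j|)+\sum_{i=1}^n v^1(x_i),$$ where the first sum runs over ordered pairs $(i,j)$ with $i\neq j$. Connectedness. The bonding graph of a configuration $D_n$ joins two atoms of $D_n$ exactly when they are at distance $1$; connected components of $D_n$ are those of this graph. Empirical measure. For $D_n=\{x_1,\dots,x_n\}\in\mathcal{C}_n$, $\mu_{D_n}:=\frac1n\sum_{i=1}^n\delta_{x_i/\sqrt n}$, where $\delta_z$ is the Dirac measure at $z$. *)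

theory Defs
  imports "HOL-Probability.Probability"
begin

definition substrate_region :: "(real \<times> real) set" where
  "substrate_region = UNIV \<times> {r. r < 0}"

text \<open>
  A lattice subset \<open>L\<close> of a region \<open>R\<close>: the part lying in \<open>R\<close> of a doubly periodic point set with
  finite motif \<open>M\<close> (\<open>M = {0}\<close> gives Bravais lattices, larger \<open>M\<close> multi-lattices).  Restricting to
  \<open>R\<close> is needed because no full-rank lattice fits into a half-plane.
\<close>
definition lattice_in :: "(real \<times> real) set \<Rightarrow> (real \<times> real) set \<Rightarrow> bool" where
  "lattice_in R L \<longleftrightarrow>
     (\<exists>a b M. a \<noteq> b \<and> independent {a, b} \<and> finite M \<and>
        L = {m + of_int k1 *\<^sub>R a + of_int k2 *\<^sub>R b | m k1 k2. m \<in> M} \<inter> R)"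

definition t1 :: "real \<times> real" where "t1 = (1, 0)"
definition t2 :: "real \<times> real" where "t2 = (1/2) *\<^sub>R (1, sqrt 3)"

definition film_lattice :: "real \<Rightarrow> (real \<times> real) set" where
  "film_lattice eS = {(0, eS) + of_int k1 *\<^sub>R t1 + of_nat k2 *\<^sub>R t2 | (k1::int) (k2::nat). True}"

definition configurations :: "real \<Rightarrow> nat \<Rightarrow> (real \<times> real) set set" where
  "configurations eS n = {D. D \<subseteq> film_lattice eS \<and> finite D \<and> card D = n}"

text \<open>The sticky-disc potential with bond length \<open>e\<close> and bond strength \<open>c\<close>.\<close>
definition sticky_potential :: "real \<Rightarrow> real \<Rightarrow> real \<Rightarrow> ereal" where
  "sticky_potential e c r = (if r < e then \<infinity> else if r = e then ereal (- c) else 0)"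

text \<open>On the film lattice the unconditional sum below has at most one nonzero term,
  see \<open>substrate_potential_film_lattice\<close>.\<close>
definition substrate_potential ::
  "real \<Rightarrow> real \<Rightarrow> (real \<times> real) set \<Rightarrow> real \<times> real \<Rightarrow> ereal" where
  "substrate_potential eS cS LS x = (\<Sum>\<^sub>\<infinity>s\<in>LS. sticky_potential eS cS (dist x s))"

definition energy ::
  "real \<Rightarrow> real \<Rightarrow> real \<Rightarrow> (real \<times> real) set \<Rightarrow> (real \<times> real) set \<Rightarrow> ereal" where
  "energy eS cF cS LS D =
     (\<Sum>(x, y) \<in> {(x, y) \<in> D \<times> D. x \<noteq> y}. sticky_potential 1 cF (dist x y))
     + (\<Sum>x\<in>D. substrate_potential eS cS LS x)"

definition bonds :: "(real \<times> real) set \<Rightarrow> (real \<times> real) rel" where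
  "bonds D = {(x, y) \<in> D \<times> D. dist x y = 1}"

definition bond_components :: "(real \<times> real) set \<Rightarrow> (real \<times> real) set set" where
  "bond_components D = {(bonds D)\<^sup>* `` {x} | x. x \<in> D}"

definition rescale :: "nat \<Rightarrow> real \<times> real \<Rightarrow> real \<times> real" where
  "rescale n x = x /\<^sub>R sqrt (real n)"

text \<open>Here \<open>return borel z\<close> is the Dirac measure at \<open>z\<close>, and the number of atoms is \<open>card D\<close>.\<close>
definition empirical_measure :: "(real \<times> real) set \<Rightarrow> (real \<times> real) measure" where
  "empirical_measure D = measure_of UNIV (sets borel)
     (\<lambda>A. (\<Sum>x\<in>D. emeasure (return borel (rescale (card D) x)) A) / of_nat (card D))"

lemma emeasure_empirical_measure:
  assumes A: "A \<in> sets borel"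
  shows "emeasure (empirical_measure D) A =
    (\<Sum>x\<in>D. emeasure (return borel (rescale (card D) x)) A) / of_nat (card D)"
proof -
  let ?N = "\<lambda>x. return borel (rescale (card D) x)"
  let ?f = "\<lambda>A. (\<Sum>x\<in>D. emeasure (?N x) A) / of_nat (card D) :: ennreal"
  have ca: "countably_additive (sets borel) ?f"
  proof (rule countably_additiveI)
    fix B :: "nat \<Rightarrow> (real \<times> real) set"
    assume B: "range B \<subseteq> sets borel" "disjoint_family B"
    have "(\<Sum>i. ?f (B i)) = (\<Sum>i. \<Sum>x\<in>D. emeasure (?N x) (B i)) / of_nat (card D)"
      by (simp add: divide_ennreal_def ennreal_suminf_multc)
    also have "(\<Sum>i. \<Sum>x\<in>D. emeasure (?N x) (B i)) = (\<Sum>x\<in>D. \<Sum>i. emeasure (?N x) (B i))"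
      by (rule suminf_sum) auto
    also have "\<dots> = (\<Sum>x\<in>D. emeasure (?N x) (\<Union>i. B i))"
      by (intro sum.cong refl suminf_emeasure) (use B in auto)
    finally show "(\<Sum>i. ?f (B i)) = ?f (\<Union>i. B i)" .
  qed
  have sa: "sigma_algebra UNIV (sets (borel :: (real \<times> real) measure))"
    using sets.sigma_algebra_axioms[of "borel :: (real \<times> real) measure"] by simp
  have "positive (sets borel) ?f" by (simp add: positive_def)
  from emeasure_measure_of_sigma[OF sa this ca A]
  show ?thesis unfolding empirical_measure_def .
qed

lemma substrate_potential_film_lattice:
  assumes eS: "eS > 0" and sub: "LS \<subseteq> closure substrate_region"
    and bd: "LS \<inter> (UNIV \<times> {0}) = {(of_int k * eS, 0) | k::int. True}"
    and x: "x \<in> film_lattice eS"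
  shows "substrate_potential eS cS LS x =
    (if x \<in> {(0, eS) + of_int k *\<^sub>R t1 | k::int. True} \<inter> (\<lambda>s. s + eS *\<^sub>R (0, 1)) ` (LS \<inter> (UNIV \<times> {0}))
     then ereal (- cS) else 0)"
proof -
  obtain k1 :: int and k2 :: nat where xk: "x = (0, eS) + of_int k1 *\<^sub>R t1 + of_nat k2 *\<^sub>R t2"
    using x by (auto simp: film_lattice_def)
  have snd_x: "snd x = eS + real k2 * (sqrt 3 / 2)" by (simp add: xk t1_def t2_def)
  then have snd_ge: "snd x \<ge> eS" by simp
  have LS_le: "snd s \<le> 0" if "s \<in> LS" for s
  proof -
    have "closure substrate_region \<subseteq> UNIV \<times> {r. r \<le> 0}"
      unfolding substrate_region_def
      by (rule closure_minimal)
        (auto intro!: closed_Times simp: closed_atMost[unfolded atMost_def])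
    then show ?thesis using sub that by (auto simp: mem_Times_iff)
  qed
  define y where "y = x - (0, eS)"
  have far: "dist x s \<ge> eS \<and> (dist x s = eS \<longleftrightarrow> s = y \<and> snd y = 0)" if "s \<in> LS" for s
  proof -
    have s: "snd s \<le> 0" using LS_le that .
    have d1: "snd x - snd s \<ge> eS" using s snd_ge by simp
    have sq: "(dist x s)\<^sup>2 = (fst x - fst s)\<^sup>2 + (snd x - snd s)\<^sup>2"
      by (simp add: dist_prod_def dist_real_def)
    have "dist (snd x) (snd s) \<le> dist x s" by (rule dist_snd_le)
    then have ge: "dist x s \<ge> snd x - snd s" by (simp add: dist_real_def)
    have "s = y \<and> snd y = 0" if "dist x s = eS"
    proof -
      have e: "snd x - snd s = eS" using ge d1 that by simp
      then have "(fst x - fst s)\<^sup>2 = 0" using sq that by simp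
      moreover have "snd x = eS" "snd s = 0" using e s snd_ge by auto
      ultimately show ?thesis by (auto simp: y_def prod_eq_iff)
    qed
    moreover have "dist x s = eS" if "s = y"
      using that eS by (simp add: y_def dist_norm norm_Pair)
    ultimately show ?thesis using ge d1 by auto
  qed
  have pot: "sticky_potential eS cS (dist x s) = (if s = y \<and> snd y = 0 then ereal (- cS) else 0)"
    if "s \<in> LS" for s using far[OF that] by (auto simp: sticky_potential_def)
  have "substrate_potential eS cS LS x =
      (\<Sum>\<^sub>\<infinity>s\<in>LS \<inter> {y}. if snd y = 0 then ereal (- cS) else 0)"
    unfolding substrate_potential_def
    by (rule infsum_cong_neutral) (auto simp: pot)
  also have "\<dots> = (if y \<in> LS \<and> snd y = 0 then ereal (- cS) else 0)"
    by auto
  also have "(y \<in> LS \<and> snd y = 0) \<longleftrightarrow>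
    x \<in> {(0, eS) + of_int k *\<^sub>R t1 | k::int. True} \<inter> (\<lambda>s. s + eS *\<^sub>R (0, 1)) ` (LS \<inter> (UNIV \<times> {0}))"
  proof -
    have "x \<in> {(0, eS) + of_int k *\<^sub>R t1 | k::int. True} \<longleftrightarrow> snd x = eS"
    proof
      assume "snd x = eS"
      then have "k2 = 0" using snd_x by simp
      then show "x \<in> {(0, eS) + of_int k *\<^sub>R t1 | k::int. True}" using xk by auto
    qed (auto simp: t1_def)
    moreover have "x \<in> (\<lambda>s. s + eS *\<^sub>R (0, 1)) ` (LS \<inter> (UNIV \<times> {0})) \<longleftrightarrow> y \<in> LS \<and> snd y = 0"
    proof
      assume "y \<in> LS \<and> snd y = 0"
      moreover have "x = y + eS *\<^sub>R (0, 1)" by (simp add: y_def)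
      ultimately show "x \<in> (\<lambda>s. s + eS *\<^sub>R (0, 1)) ` (LS \<inter> (UNIV \<times> {0}))"
        by (auto simp: mem_Times_iff)
    qed (auto simp: y_def)
    ultimately show ?thesis by (auto simp: y_def)
  qed
  finally show ?thesis .
qed

end

theory Submission
  imports Defs "HOL-Real_Asymp.Real_Asymp"
begin

text \<open>
  In the coordinates \<open>(k\<^sub>1, k\<^sub>2)\<close> of the film lattice a configuration is a finite set of pairs of
  integers with \<open>k\<^sub>2 \<ge> 0\<close>, every point has six possible neighbours, and the energy of \<open>A\<close> is, up to the
  constant \<open>- 6 c\<^sub>F #A\<close>, its \<^emph>\<open>surplus\<close>: \<open>c\<^sub>F\<close> times the number of missing bonds minus \<open>c\<^sub>S\<close> times the
  number of atoms sitting on substrate sites (\<open>energy_site\<close>). Let \<open>E m\<close> be the least surplus of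
  \<open>m\<close> atoms.

  Under the dewetting condition the missing bonds outweigh the contacts with the substrate
  (\<open>deficiency_le_surplus\<close>), and so \<open>E m\<close> lies between two positive multiples of \<open>\<surd>m\<close>
  (\<open>least_surplus_lower\<close>, \<open>least_surplus_upper\<close>).

  The heart of the proof is that \<open>E\<close> is midpoint concave up to an error of order \<open>m\<^bsup>1/4\<^esup>\<close>
  (\<open>least_surplus_approx_concave\<close>). The surplus is a submodular set function, being a lattice perimeter
  minus a measure. Take a minimiser \<open>A\<close> with \<open>a\<close> atoms and let a copy of it slide away along the substrate,
  in steps of one period \<open>q\<close> of the substrate sites. The overlap decreases from \<open>a\<close> to \<open>0\<close> in small
  steps, so that for every \<open>d \<le> a\<close> some overlap is close to \<open>a - d\<close> and the union then has
  about \<open>a + d\<close> atoms. Submodularity reads \<open>E (a + d) + E (a - d) \<le> 2 E a\<close> up to the error.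

  If a minimiser of \<open>n\<close> atoms splits into two parts without bonds between them, of sizes \<open>a\<close> and
  \<open>n - a\<close>, then \<open>E a + E (n - a) \<le> E n\<close>. If neither part were small, concavity would make this hold
  approximately with \<open>a\<close> replaced by a number \<open>s\<close> that is a small fixed proportion of \<open>n\<close>. But, up to
  the error, \<open>E n - E (n - s)\<close> is at most of order \<open>s / \<surd>n\<close>, again by concavity, and \<open>E s\<close> is at
  least of order \<open>\<surd>s\<close>: a contradiction
  (\<open>exact_splitting_is_lopsided\<close>). So every union of connected components of a minimiser contains a
  proportion of atoms close to \<open>0\<close> or to \<open>1\<close>. Were all components small, some union of them
  would have an intermediate size. Hence the largest one is of proportion close to \<open>1\<close>
  (\<open>largest_component_dominates\<close>).
\<close>

section \<open>Approximately concave sequences\<close>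

text \<open>
  The error enters only once, although midpoint concavity usually has to be iterated: at a point
  \<open>z\<close> where \<open>f\<close> is least, reflect the nearer end at \<open>z\<close>; the reflected point stays in the
  interval, so its value is at least \<open>f z\<close>.
\<close>
lemma approx_concave_ge_ends:
  fixes f :: "nat \<Rightarrow> real"
  assumes mid: "\<And>x d. l + d \<le> x \<Longrightarrow> x + d \<le> u \<Longrightarrow> f (x + d) + f (x - d) \<le> 2 * f x + e"
    and ends: "G \<le> f l" "G \<le> f u" and x: "l \<le> x" "x \<le> u"
  shows "G - e \<le> f x"
proof -
  have "Min (f ` {l..u}) \<in> f ` {l..u}" using x by (intro Min_in) auto
  then obtain z where z: "l \<le> z" "z \<le> u" and fz: "f z = Min (f ` {l..u})" by auto
  have least: "f z \<le> f y" if "l \<le> y" "y \<le> u" for y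
    unfolding fz using that by (intro Min_le) auto
  have "G - e \<le> f z"
  proof (cases "z - l \<le> u - z")
    case True
    then have "z + (z - l) \<le> u" using z by simp
    then show ?thesis
      using mid[of "z - l" z] least[of "z + (z - l)"] z ends by (simp del: add_diff_assoc)
  next
    case False
    then have "l + (u - z) \<le> z" "l \<le> z - (u - z)" "z - (u - z) \<le> u" using z by auto
    then show ?thesis
      using mid[of "u - z" z] least[of "z - (u - z)"] z ends by (simp del: diff_diff_right)
  qed
  then show ?thesis using least[OF x] by simp
qed

text \<open>
  Suppose that neither \<open>a\<close> nor \<open>n - a\<close> is small, and let \<open>s\<close> be about \<open>\<eta> n\<close> with \<open>\<eta>\<close> small. The
  function \<open>x \<mapsto> E x + E (n - x)\<close> is approximately concave and takes equal values at \<open>s\<close> and \<open>n -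
  s\<close>, hence \<open>E s + E (n - s)\<close> hardly exceeds \<open>E a + E (n - a) \<le> E n\<close>. Concavity of \<open>E\<close> itself
  bounds \<open>E (n - s)\<close> from below by \<open>(1 - s/n) E n\<close> approximately. Together, \<open>E s\<close> is at most \<open>\<eta>
  E n \<le> C \<eta> \<surd>n\<close> up to the error, of order \<open>n\<^bsup>1/4\<^esup>\<close>, against \<open>E s \<ge> c \<surd>s\<close>, which is of order \<open>\<surd>\<eta>
  \<surd>n\<close>.
\<close>
lemma exact_splitting_is_lopsided:
  fixes E :: "nat \<Rightarrow> real"
  assumes c: "0 < c" and K: "0 \<le> K"
    and lower: "\<And>m. c * sqrt (real m) \<le> E m"
    and upper: "\<And>m. E m \<le> C * sqrt (real m)"
    and concave: "\<And>a d. d \<le> a \<Longrightarrow> E (a + d) + E (a - d) \<le> 2 * E a + K * sqrt (sqrt (real a))"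
    and eps: "0 < \<epsilon>"
  shows "\<exists>N. \<forall>n\<ge>N. \<forall>a\<le>n. E a + E (n - a) \<le> E n \<longrightarrow>
           real a < \<epsilon> * real n \<or> (1 - \<epsilon>) * real n < real a"
proof -
  have cC: "c \<le> C" using lower[of 1] upper[of 1] by simp
  then have C: "0 < C" using c by simp
  \<comment> \<open>The second bound on \<open>\<eta>\<close> makes \<open>C \<eta>\<close> at most \<open>c \<surd>\<eta> / 2\<close>, less than \<open>c \<surd>(\<eta> / 2)\<close>; the
      \<open>\<eta> / 2\<close> leaves room for rounding \<open>\<eta> n\<close> to an integer.\<close>
  define \<eta> where "\<eta> = min \<epsilon> (c\<^sup>2 / (4 * C\<^sup>2))"
  have \<eta>: "0 < \<eta>" "\<eta> \<le> \<epsilon>" using eps c C by (auto simp: \<eta>_def)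
  have "C\<^sup>2 * \<eta> \<le> c\<^sup>2 / 4"
  proof -
    have "C\<^sup>2 * \<eta> \<le> C\<^sup>2 * (c\<^sup>2 / (4 * C\<^sup>2))" by (intro mult_left_mono) (auto simp: \<eta>_def)
    then show ?thesis using C by simp
  qed
  then have "C\<^sup>2 * \<eta> * \<eta> \<le> c\<^sup>2 / 4 * \<eta>" using \<eta> by (intro mult_right_mono) auto
  also have "\<dots> < c\<^sup>2 * (\<eta> / 2)" using \<eta> c by simp
  finally have "(C * \<eta>)\<^sup>2 < c\<^sup>2 * (\<eta> / 2)" by (simp add: power2_eq_square ac_simps)
  also have "\<dots> = (c * sqrt (\<eta> / 2))\<^sup>2" using \<eta> by (simp add: power_mult_distrib)
  finally have "C * \<eta> < c * sqrt (\<eta> / 2)"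
    by (rule power2_less_imp_less) (use c \<eta> in auto)
  then have \<gamma>: "0 < c * sqrt (\<eta> / 2) - C * \<eta>" (is "0 < ?\<gamma>") by simp
  have lim: "filterlim (\<lambda>n. sqrt (sqrt (real n))) at_top sequentially"
    by real_asymp
  have "\<forall>\<^sub>F n in sequentially. 3 * K / ?\<gamma> < sqrt (sqrt (real n))"
    using lim by (auto simp: filterlim_at_top_dense)
  moreover have "\<forall>\<^sub>F n in sequentially. 2 / \<eta> \<le> real n"
    using filterlim_real_sequentially by (auto simp: filterlim_at_top)
  ultimately have "\<forall>\<^sub>F n in sequentially. 3 * K / ?\<gamma> < sqrt (sqrt (real n)) \<and> 2 / \<eta> \<le> real n"
    by (rule eventually_conj)
  then obtain N where N: "\<And>n. N \<le> n \<Longrightarrow> 3 * K / ?\<gamma> < sqrt (sqrt (real n))"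
      "\<And>n. N \<le> n \<Longrightarrow> 2 / \<eta> \<le> real n"
    by (auto simp: eventually_sequentially)
  have "real a < \<epsilon> * real n \<or> (1 - \<epsilon>) * real n < real a"
    if n: "N \<le> n" and a: "a \<le> n" and split: "E a + E (n - a) \<le> E n" for n a
  proof (rule ccontr)
    assume "\<not> ?thesis"
    then have mid: "\<epsilon> * real n \<le> real a" "\<epsilon> * real n \<le> real (n - a)"
      using a by (auto simp: of_nat_diff algebra_simps)
    have n_pos: "0 < n" using N(2)[OF n] \<eta> by (cases n) (auto simp: field_simps)
    define e where "e = K * sqrt (sqrt (real n))"
    define s where "s = nat \<lfloor>\<eta> * real n\<rfloor>"
    have s_le: "real s \<le> \<eta> * real n" using \<eta> by (simp add: s_def)
    have s_ge: "\<eta> * real n / 2 \<le> real s"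
      using N(2)[OF n] \<eta> unfolding s_def by (simp add: field_simps) linarith
    have "\<eta> * real n \<le> \<epsilon> * real n" using \<eta> by (intro mult_right_mono) auto
    then have "real s \<le> real a" "real s \<le> real (n - a)" using s_le mid by linarith+
    then have s: "s \<le> a" "s \<le> n - a" by (simp_all only: of_nat_le_iff)
    have err: "K * sqrt (sqrt (real x)) \<le> e" if "x \<le> n" for x
      unfolding e_def using K that by (intro mult_left_mono) auto
    have E0: "E 0 = 0" using lower[of 0] upper[of 0] by simp
    \<comment> \<open>\<open>E\<close> lies above its chord on \<open>{0..n}\<close>, up to \<open>e\<close>.\<close>
    have chord: "0 - e \<le> E (n - s) - real (n - s) / real n * E n"
    proof (rule approx_concave_ge_ends[where l = 0 and u = n
          and f = "\<lambda>x. E x - real x / real n * E n"])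
      fix x d assume "0 + d \<le> x" "x + d \<le> n"
      then show "E (x + d) - real (x + d) / real n * E n + (E (x - d) - real (x - d) / real n * E n)
          \<le> 2 * (E x - real x / real n * E n) + e"
        using concave[of d x] err[of x]
        by (simp add: of_nat_diff add_divide_distrib diff_divide_distrib algebra_simps)
    qed (use E0 n_pos in auto)
    have "E s + E (n - s) - 2 * e \<le> E a + E (n - a)"
    proof (rule approx_concave_ge_ends[where l = s and u = "n - s"
          and f = "\<lambda>x. E x + E (n - x)"])
      fix x d assume xd: "s + d \<le> x" "x + d \<le> n - s"
      then have "x \<le> n" "d \<le> x" "d \<le> n - x" "n - (x + d) = n - x - d" "n - (x - d) = n - x + d"
        by auto
      then show "E (x + d) + E (n - (x + d)) + (E (x - d) + E (n - (x - d)))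
          \<le> 2 * (E x + E (n - x)) + 2 * e"
        using concave[of d x] err[of x] concave[of d "n - x"] err[of "n - x"]
        by (simp del: of_nat_diff Nat.diff_diff_right diff_diff_left)
    qed (use s a in auto)
    then have "E s \<le> real s / real n * E n + 3 * e"
      using chord split s a n_pos by (simp add: of_nat_diff diff_divide_distrib algebra_simps)
    also have "real s / real n * E n \<le> \<eta> * (C * sqrt (real n))"
      using s_le n_pos lower[of n] c upper[of n] \<eta>
      by (intro mult_mono) (auto simp: field_simps intro: order_trans[rotated])
    finally have "c * sqrt (real s) \<le> C * \<eta> * sqrt (real n) + 3 * e"
      using lower[of s] by (simp add: algebra_simps)
    moreover have "c * (sqrt (\<eta> / 2) * sqrt (real n)) \<le> c * sqrt (real s)"
      unfolding real_sqrt_mult[symmetric] using c s_ge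
      by (intro mult_left_mono) (auto intro!: real_sqrt_le_mono)
    ultimately have "?\<gamma> * sqrt (real n) \<le> 3 * e" by (simp add: algebra_simps)
    also have "sqrt (real n) = sqrt (sqrt (real n)) * sqrt (sqrt (real n))" by simp
    finally have "?\<gamma> * sqrt (sqrt (real n)) \<le> 3 * K"
      using n_pos by (simp add: e_def flip: mult.assoc del: real_sqrt_mult_self)
    then show False using N(1)[OF n] \<gamma> by (simp add: field_simps)
  qed
  then show ?thesis by blast
qed

section \<open>Missing bonds in the triangular lattice\<close>

definition directions :: "(int \<times> int) set" where
  "directions = {(1, 0), (-1, 0), (0, 1), (0, -1), (1, -1), (-1, 1)}"

definition exposed :: "(int \<times> int) set \<Rightarrow> int \<times> int \<Rightarrow> (int \<times> int) set" where
  "exposed A v = {x \<in> A. x + v \<notin> A}"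

definition deficiency :: "(int \<times> int) set \<Rightarrow> nat" where
  "deficiency A = (\<Sum>v\<in>directions. card (exposed A v))"

definition shapes :: "nat \<Rightarrow> (int \<times> int) set set" where
  "shapes m = {A. finite A \<and> card A = m \<and> (\<forall>x\<in>A. 0 \<le> snd x)}"

lemma finite_directions [simp]: "finite directions"
  and card_directions [simp]: "card directions = 6"
  and uminus_directions: "uminus ` directions = directions"
  by (auto simp: directions_def)

lemma finite_exposed [simp]: "finite A \<Longrightarrow> finite (exposed A v)"
  by (simp add: exposed_def)

lemma deficiency_eq:
  "deficiency A = card (exposed A (1, 0)) + card (exposed A (-1, 0)) + card (exposed A (0, 1))
     + card (exposed A (0, -1)) + card (exposed A (1, -1)) + card (exposed A (-1, 1))"
  by (simp add: deficiency_def directions_def)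

lemma deficiency_translate: "deficiency ((+) t ` A) = deficiency A"
proof -
  have "exposed ((+) t ` A) v = (+) t ` exposed A v" for v
    by (auto simp: exposed_def image_iff add.assoc)
  then show ?thesis by (simp add: deficiency_def card_image)
qed

text \<open>
  The surplus inherits this inequality, and it is used twice: for disjoint sets it gives
  subadditivity, and for overlapping translates of one set it gives approximate concavity.
\<close>
lemma deficiency_submodular:
  assumes "finite A" "finite B"
  shows "deficiency (A \<union> B) + deficiency (A \<inter> B) \<le> deficiency A + deficiency B"
proof -
  have "card (exposed (A \<union> B) v) + card (exposed (A \<inter> B) v)
      \<le> card (exposed A v) + card (exposed B v)" for v
  proof -
    let ?U = "exposed (A \<union> B) v" and ?I = "exposed (A \<inter> B) v"
    have "card ?U + card ?I = card (?U \<union> ?I) + card (?U \<inter> ?I)"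
      using assms by (intro card_Un_Int) auto
    also have "\<dots> \<le> card (exposed A v \<union> exposed B v) + card (exposed A v \<inter> exposed B v)"
      using assms by (intro add_mono card_mono) (auto simp: exposed_def)
    also have "\<dots> = card (exposed A v) + card (exposed B v)"
      using assms by (intro card_Un_Int[symmetric]) auto
    finally show ?thesis .
  qed
  then show ?thesis
    unfolding deficiency_def sum.distrib[symmetric] by (rule sum_mono)
qed

text \<open>
  A bond missing in one part cannot be supplied by the other. The hypothesis says so for the
  points of \<open>U\<close>; for the others it follows because the directions come in opposite pairs.
\<close>
lemma deficiency_split:
  assumes A: "finite A" and U: "U \<subseteq> A"
    and sep: "\<And>x v. x \<in> U \<Longrightarrow> v \<in> directions \<Longrightarrow> x + v \<in> A \<Longrightarrow> x + v \<in> U"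
  shows "deficiency A = deficiency U + deficiency (A - U)"
proof -
  have "card (exposed A v) = card (exposed U v) + card (exposed (A - U) v)"
    if v: "v \<in> directions" for v
  proof -
    have neg: "- v \<in> directions" using v uminus_directions by blast
    have "exposed A v = exposed U v \<union> exposed (A - U) v"
    proof -
      have "x + v \<in> A - U" if "x \<in> A - U" "x + v \<in> A" for x
        using sep[OF _ neg, of "x + v"] that by auto
      then show ?thesis using U sep[OF _ v] by (auto simp: exposed_def)
    qed
    then show ?thesis
      using A U by (simp add: card_Un_disjoint exposed_def finite_subset disjoint_iff)
  qed
  then show ?thesis unfolding deficiency_def sum.distrib[symmetric] by (rule sum.cong[OF refl])
qed

text \<open>
  A removed point no longer misses its \<open>6 - k\<close> bonds, where \<open>k\<close> is its number of neighbours, and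
  each of these \<open>k\<close> neighbours misses one more: the balance is \<open>2 k - 6\<close>.
\<close>
lemma deficiency_remove:
  assumes A: "finite A" and x: "x \<in> A"
  shows "deficiency (A - {x}) + 6 \<le> deficiency A + 2 * card {v \<in> directions. x + v \<in> A}"
proof -
  have "card (exposed (A - {x}) v) + 1
      \<le> card (exposed A v) + of_bool (x + v \<in> A) + of_bool (x + - v \<in> A)"
    if v: "v \<in> directions" for v
  proof -
    have "exposed (A - {x}) v \<subseteq> (exposed A v - {x}) \<union> (if x + - v \<in> A then {x - v} else {})"
      by (auto simp: exposed_def)
    then have "card (exposed (A - {x}) v) \<le> card (exposed A v - {x}) + of_bool (x + - v \<in> A)"
      using A by (intro order_trans[OF card_mono order_trans[OF card_Un_le]]) auto
    moreover have "card (exposed A v - {x}) + 1 \<le> card (exposed A v) + of_bool (x + v \<in> A)"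
    proof (cases "x + v \<in> A")
      case False
      then have "x \<in> exposed A v" using x by (simp add: exposed_def)
      then show ?thesis using A False card_Suc_Diff1[of "exposed A v" x] by simp
    qed (use A in \<open>simp add: card_mono\<close>)
    ultimately show ?thesis by simp
  qed
  then have "(\<Sum>v\<in>directions. card (exposed (A - {x}) v) + 1)
      \<le> (\<Sum>v\<in>directions. card (exposed A v) + of_bool (x + v \<in> A) + of_bool (x + - v \<in> A))"
    by (rule sum_mono)
  moreover have "(\<Sum>v\<in>directions. of_bool (x + - v \<in> A)) = (\<Sum>v\<in>directions. of_bool (x + v \<in> A) :: nat)"
    by (rule sum.reindex_bij_witness[where i = uminus and j = uminus])
      (use uminus_directions in force)+
  moreover have "(\<Sum>v\<in>directions. of_bool (x + v \<in> A) :: nat) = card {v \<in> directions. x + v \<in> A}"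
    by (simp add: Int_def)
  ultimately show ?thesis
    unfolding deficiency_def sum.distrib by simp
qed

text \<open>
  The fibres of \<open>f\<close> are unions of lattice lines in direction \<open>v\<close>, and the last point of \<open>A\<close> in a
  fibre, as measured by \<open>\<phi>\<close>, lacks its neighbour in direction \<open>v\<close>.
\<close>
lemma card_image_le_card_exposed:
  fixes f \<phi> :: "int \<times> int \<Rightarrow> int"
  assumes A: "finite A" and f: "\<And>x. f (x + v) = f x" and up: "\<And>x. \<phi> x < \<phi> (x + v)"
  shows "card (f ` A) \<le> card (exposed A v)"
proof -
  have "f ` A \<subseteq> f ` exposed A v"
  proof
    fix y assume "y \<in> f ` A"
    then have "{x \<in> A. f x = y} \<noteq> {}" by auto
    then have "Max (\<phi> ` {x \<in> A. f x = y}) \<in> \<phi> ` {x \<in> A. f x = y}" using A by (intro Max_in) auto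
    then obtain z where z: "z \<in> A" "f z = y" and M: "\<phi> z = Max (\<phi> ` {x \<in> A. f x = y})" by auto
    have "z + v \<notin> A"
    proof
      assume "z + v \<in> A"
      then have "\<phi> (z + v) \<le> \<phi> z" unfolding M using A z f by (intro Max_ge) auto
      then show False using up[of z] by simp
    qed
    then show "y \<in> f ` exposed A v" using z by (auto simp: exposed_def)
  qed
  then show ?thesis using A by (meson card_image_le card_mono finite_exposed finite_imageI le_trans)
qed

text \<open>
  A crude isoperimetric inequality: a set is contained in the product of its two projections,
  and each point of a projection accounts for a missing bond.
\<close>
lemma sqrt_card_le_deficiency:
  assumes A: "finite A"
  shows "sqrt (real (card A)) \<le> real (deficiency A)"
proof -
  have "card (fst ` A) \<le> card (exposed A (0, 1))"
    by (rule card_image_le_card_exposed[where \<phi> = snd]) (use A in auto)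
  moreover have "card (snd ` A) \<le> card (exposed A (1, 0))"
    by (rule card_image_le_card_exposed[where \<phi> = fst]) (use A in auto)
  ultimately have le: "card (fst ` A) \<le> deficiency A" "card (snd ` A) \<le> deficiency A"
    by (simp_all add: deficiency_eq)
  have "A \<subseteq> fst ` A \<times> snd ` A" by force
  then have "card A \<le> card (fst ` A \<times> snd ` A)" using A by (intro card_mono) auto
  also have "\<dots> \<le> deficiency A * deficiency A"
    unfolding card_cartesian_product using le by (rule mult_le_mono)
  finally have "real (card A) \<le> (real (deficiency A))\<^sup>2"
    by (metis of_nat_le_iff of_nat_power power2_eq_square)
  then show ?thesis by (rule real_le_lsqrt[OF of_nat_0_le_iff])
qed

text \<open>
  A point of the bottom row misses both bonds downwards, and it is responsible for one missing
  bond at the upper end of each of the two slanted lattice lines through it. The horizontal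
  bonds missing in the bottom row come in addition.
\<close>
lemma bottom_row_le_deficiency:
  fixes A :: "(int \<times> int) set"
  assumes A: "finite A" "\<forall>x\<in>A. 0 \<le> snd x"
  defines "B \<equiv> {x \<in> A. snd x = 0}"
  shows "4 * card B + card (B \<inter> exposed A (1, 0)) + card (B \<inter> exposed A (-1, 0)) \<le> deficiency A"
proof -
  have fin: "finite B" "B \<subseteq> A" using A by (auto simp: B_def)
  have "card B = card (fst ` B)"
    by (intro card_image[symmetric] inj_onI) (auto simp: B_def prod_eq_iff)
  also have "\<dots> \<le> card (fst ` A)" using fin A by (intro card_mono) auto
  also have "\<dots> \<le> card (exposed A (0, 1))"
    by (rule card_image_le_card_exposed[where \<phi> = snd]) (use A in auto)
  finally have 1: "card B \<le> card (exposed A (0, 1))" .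
  have "card B = card ((\<lambda>x. fst x + snd x) ` B)"
    by (intro card_image[symmetric] inj_onI) (auto simp: B_def prod_eq_iff)
  also have "\<dots> \<le> card ((\<lambda>x. fst x + snd x) ` A)" using fin A by (intro card_mono) auto
  also have "\<dots> \<le> card (exposed A (-1, 1))"
    by (rule card_image_le_card_exposed[where \<phi> = snd]) (use A in auto)
  finally have 2: "card B \<le> card (exposed A (-1, 1))" .
  have 3: "card B \<le> card (exposed A (i, -1))" for i
    using A by (intro card_mono) (force simp: B_def exposed_def)+
  have 4: "card (B \<inter> exposed A v) \<le> card (exposed A v)" for v
    using A by (intro card_mono) auto
  show ?thesis
    unfolding deficiency_eq using 1 2 3[of 0] 3[of 1] 4[of "(1, 0)"] 4[of "(-1, 0)"] by linarith
qed

lemma deficiency_square_le: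
  "deficiency ({0..<int k} \<times> {0..<int k}) \<le> 24 * k"
proof -
  let ?I = "{0..<int k}"
  let ?R = "{0, int k - 1}"
  have "card (exposed (?I \<times> ?I) v) \<le> 4 * k" if v: "v \<in> directions" for v
  proof -
    have "exposed (?I \<times> ?I) v \<subseteq> (?R \<times> ?I) \<union> (?I \<times> ?R)"
      using v by (auto simp: exposed_def directions_def)
    then have "card (exposed (?I \<times> ?I) v) \<le> card ((?R \<times> ?I) \<union> (?I \<times> ?R))"
      by (intro card_mono) auto
    also have "\<dots> \<le> card ?R * k + k * card ?R"
      by (rule order_trans[OF card_Un_le]) simp
    also have "\<dots> \<le> 2 * k + k * 2"
      by (intro add_mono mult_le_mono) (auto intro: order_trans[OF card_insert_le_m1])
    finally show ?thesis by simp
  qed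
  then have "deficiency (?I \<times> ?I) \<le> of_nat (card directions) * (4 * k)"
    unfolding deficiency_def by (intro sum_bounded_above) auto
  then show ?thesis by simp
qed

text \<open>
  A unit shift uncovers only the left ends of horizontal runs; a shift by \<open>j\<close> is \<open>j\<close> unit
  shifts.
\<close>
lemma card_shift_diff_le:
  assumes A: "finite A"
  shows "card (A - (+) (int j, 0) ` A) \<le> j * card (exposed A (-1, 0))"
proof (induction j)
  case 0
  show ?case by (simp add: zero_prod_def[symmetric])
next
  case (Suc j)
  let ?T = "\<lambda>i :: int. (+) (i, 0 :: int)"
  have "A - ?T (int (Suc j)) ` A \<subseteq> exposed A (-1, 0) \<union> ?T 1 ` (A - ?T (int j) ` A)"
  proof
    fix x assume x: "x \<in> A - ?T (int (Suc j)) ` A"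
    show "x \<in> exposed A (-1, 0) \<union> ?T 1 ` (A - ?T (int j) ` A)"
    proof (cases "x + (-1, 0) \<in> A")
      case True
      have "x + (-1, 0) \<notin> ?T (int j) ` A"
      proof
        assume "x + (-1, 0) \<in> ?T (int j) ` A"
        then obtain y where y: "y \<in> A" "x + (-1, 0) = (int j, 0) + y" by auto
        then have "x = (int (Suc j), 0) + y" by (auto simp: prod_eq_iff)
        then show False using x y by blast
      qed
      moreover have "x = (1, 0) + (x + (-1, 0))" by (simp add: prod_eq_iff)
      ultimately show ?thesis using True by blast
    qed (use x in \<open>simp add: exposed_def\<close>)
  qed
  then have "card (A - ?T (int (Suc j)) ` A)
      \<le> card (exposed A (-1, 0)) + card (?T 1 ` (A - ?T (int j) ` A))"
    using A by (intro order_trans[OF card_mono card_Un_le]) auto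
  also have "\<dots> \<le> card (exposed A (-1, 0)) + j * card (exposed A (-1, 0))"
    using Suc by (simp add: card_image)
  finally show ?case by simp
qed

lemma disjoint_translate:
  fixes A B :: "(int \<times> int) set"
  assumes "finite A" "finite B" "q \<ge> 1"
  obtains k :: nat where "A \<inter> (+) (int (k * q), 0) ` B = {}"
proof -
  define M where "M = Max (insert 0 ((\<lambda>x. \<bar>fst x\<bar>) ` A))"
  define L where "L = Max (insert 0 ((\<lambda>x. \<bar>fst x\<bar>) ` B))"
  have M: "\<bar>fst x\<bar> \<le> M" if "x \<in> A" for x using assms that unfolding M_def by (intro Max_ge) auto
  have L: "\<bar>fst x\<bar> \<le> L" if "x \<in> B" for x using assms that unfolding L_def by (intro Max_ge) auto
  define k where "k = nat (M + L + 1)"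
  have "int k * 1 \<le> int k * int q" using assms(3) by (intro mult_left_mono) auto
  moreover have "M + L + 1 \<le> int k" by (simp add: k_def)
  ultimately have k: "M + L + 1 \<le> int (k * q)" by simp
  have "A \<inter> (+) (int (k * q), 0) ` B = {}"
  proof (rule ccontr)
    assume "\<not> ?thesis"
    then obtain x where x: "x \<in> B" "(int (k * q), 0) + x \<in> A" by blast
    have "\<bar>fst x\<bar> \<le> L" using x by (intro L)
    moreover have "\<bar>fst ((int (k * q), 0) + x)\<bar> \<le> M" using x by (intro M)
    moreover have "fst ((int (k * q), 0) + x) = int (k * q) + fst x" by simp
    ultimately show False using k by linarith
  qed
  then show ?thesis by (rule that)
qed

section \<open>The least surplus\<close>

locale dewetting =
  fixes q :: nat and cF cS :: real
  assumes q_pos: "1 \<le> q" and cF_pos: "0 < cF" and cS_pos: "0 < cS"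
    and weak_substrate: "if q \<noteq> 1 then cS < 6 * cF else cS < 4 * cF"
begin

definition contact :: "(int \<times> int) set" where
  "contact = {x. snd x = 0 \<and> int q dvd fst x}"

text \<open>
  The energy of \<open>A\<close> after adding \<open>6 c\<^sub>F\<close> for each atom, so that an atom in the bulk costs
  nothing.
\<close>
definition surplus :: "(int \<times> int) set \<Rightarrow> real" where
  "surplus A = cF * real (deficiency A) - cS * real (card (A \<inter> contact))"

definition least_surplus :: "nat \<Rightarrow> real" where
  "least_surplus m = Min (surplus ` shapes m)"

text \<open>
  The dewetting condition says that this is positive; it is the part of \<open>c\<^sub>F\<close> that remains of
  each missing bond once the substrate bonds are paid for.
\<close>
definition coercivity :: real where
  "coercivity = (if q \<noteq> 1 then cF - cS / 6 else cF - cS / 4)"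

lemma coercivity_pos: "0 < coercivity"
  using weak_substrate by (simp add: coercivity_def split: if_splits)

text \<open>
  Contacts are at distance at least \<open>q\<close> in the bottom row. For \<open>q \<noteq> 1\<close> a contact therefore lacks
  a horizontal bond or shares it with an atom without contact, which is why the threshold for
  \<open>c\<^sub>S\<close> differs in the two cases.
\<close>
lemma contact_neighbour: "q \<noteq> 1 \<Longrightarrow> x \<in> contact \<Longrightarrow> x + (1, 0) \<notin> contact"
  "q \<noteq> 1 \<Longrightarrow> x \<in> contact \<Longrightarrow> x + (-1, 0) \<notin> contact"
proof -
  have *: "\<bar>j\<bar> \<noteq> 1" if "q \<noteq> 1" "int q dvd i" "int q dvd i + j" for i j :: int
  proof
    assume "\<bar>j\<bar> = 1"
    moreover have "int q dvd j" using that by (simp add: dvd_add_right_iff)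
    ultimately show False using that(1) by (metis dvd_abs_iff int_dvd_int_iff nat_dvd_1_iff_1 of_nat_1)
  qed
  show "q \<noteq> 1 \<Longrightarrow> x \<in> contact \<Longrightarrow> x + (1, 0) \<notin> contact"
    using *[of "fst x" 1] by (auto simp: contact_def)
  show "q \<noteq> 1 \<Longrightarrow> x \<in> contact \<Longrightarrow> x + (-1, 0) \<notin> contact"
    using *[of "fst x" "-1"] by (auto simp: contact_def)
qed

text \<open>
  For \<open>q = 1\<close> the four missing bonds charged to each point of the bottom row suffice. For \<open>q \<noteq>
  1\<close> let \<open>w\<close> be the number of contacts, \<open>b\<close> the size of the bottom row and \<open>r\<close>, \<open>r'\<close> the numbers
  of its missing bonds to the right and to the left. A contact either lacks its right neighbour
  or has a right neighbour that is not a contact, so that \<open>w \<le> r + (b - w)\<close>, and likewise on the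
  left. Hence \<open>6 w \<le> 2 b + (b + r) + (b + r')\<close>, at most the number of missing bonds.
\<close>
lemma card_contact_le:
  assumes A: "finite A" "\<forall>x\<in>A. 0 \<le> snd x"
  shows "(if q \<noteq> 1 then 6 else 4) * card (A \<inter> contact) \<le> deficiency A"
proof -
  define B where "B = {x \<in> A. snd x = 0}"
  have fin: "finite B" and sub: "A \<inter> contact \<subseteq> B" using A by (auto simp: B_def contact_def)
  have le: "4 * card B + card (B \<inter> exposed A (1, 0)) + card (B \<inter> exposed A (-1, 0)) \<le> deficiency A"
    using bottom_row_le_deficiency[OF A] by (simp add: B_def)
  have wB: "card (A \<inter> contact) \<le> card B" using fin sub by (rule card_mono)
  have runs: "2 * card (A \<inter> contact) \<le> card B + card (B \<inter> exposed A v)"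
    if v: "snd v = 0" "\<And>x. x \<in> contact \<Longrightarrow> x + v \<notin> contact" for v
  proof -
    have "A \<inter> contact - exposed A v \<subseteq> (\<lambda>x. x - v) ` (B - A \<inter> contact)"
    proof
      fix x assume "x \<in> A \<inter> contact - exposed A v"
      then have "x + v \<in> B - A \<inter> contact" using v by (auto simp: exposed_def B_def contact_def)
      then show "x \<in> (\<lambda>x. x - v) ` (B - A \<inter> contact)" by (force simp: image_iff)
    qed
    then have "card (A \<inter> contact - exposed A v) \<le> card (B - A \<inter> contact)"
      using fin by (intro surj_card_le) auto
    moreover have "card (B - A \<inter> contact) = card B - card (A \<inter> contact)"
      using fin sub by (intro card_Diff_subset) (auto intro: finite_subset)
    moreover have "card (A \<inter> contact) \<le> card (A \<inter> contact - exposed A v) + card (B \<inter> exposed A v)"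
      using fin sub by (intro order_trans[OF card_mono card_Un_le]) (auto intro: finite_subset)
    ultimately show ?thesis using wB by simp
  qed
  show ?thesis
  proof (cases "q = 1")
    case True
    then show ?thesis using le wB by simp
  next
    case False
    then show ?thesis using le wB runs[of "(1, 0)"] runs[of "(-1, 0)"] contact_neighbour by simp
  qed
qed

lemma deficiency_le_surplus:
  assumes "finite A" "\<forall>x\<in>A. 0 \<le> snd x"
  shows "coercivity * real (deficiency A) \<le> surplus A"
proof -
  have "real ((if q \<noteq> 1 then 6 else 4) * card (A \<inter> contact)) \<le> real (deficiency A)"
    using card_contact_le[OF assms] by (rule of_nat_mono)
  then have "cS * real (card (A \<inter> contact)) \<le> cS * (real (deficiency A) / (if q \<noteq> 1 then 6 else 4))"
    using cS_pos by (intro mult_left_mono) (auto split: if_splits)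
  then show ?thesis by (auto simp: surplus_def coercivity_def algebra_simps split: if_splits)
qed

text \<open>
  Only translations by multiples of \<open>q\<close> preserve the contacts with the substrate.
\<close>
lemma surplus_translate: "surplus ((+) (int k * int q, 0) ` A) = surplus A"
proof -
  have "(+) (int k * int q, 0) ` A \<inter> contact = (+) (int k * int q, 0) ` (A \<inter> contact)"
    by (auto simp: contact_def)
  then show ?thesis by (simp add: surplus_def deficiency_translate card_image)
qed

lemma surplus_empty [simp]: "surplus {} = 0"
  by (simp add: surplus_def deficiency_def exposed_def)

lemma surplus_submodular:
  assumes "finite A" "finite B"
  shows "surplus (A \<union> B) + surplus (A \<inter> B) \<le> surplus A + surplus B"
proof -
  have "real (deficiency (A \<union> B) + deficiency (A \<inter> B)) \<le> real (deficiency A + deficiency B)"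
    using deficiency_submodular[OF assms] by (rule of_nat_mono)
  then have "cF * (real (deficiency (A \<union> B)) + real (deficiency (A \<inter> B)))
      \<le> cF * (real (deficiency A) + real (deficiency B))"
    using cF_pos by (intro mult_left_mono) auto
  moreover have "card (A \<inter> contact) + card (B \<inter> contact)
      = card ((A \<union> B) \<inter> contact) + card ((A \<inter> B) \<inter> contact)"
  proof -
    have "(A \<union> B) \<inter> contact = A \<inter> contact \<union> B \<inter> contact"
      "(A \<inter> B) \<inter> contact = (A \<inter> contact) \<inter> (B \<inter> contact)" by auto
    then show ?thesis using assms card_Un_Int[of "A \<inter> contact" "B \<inter> contact"] by simp
  qed
  then have "real (card (A \<inter> contact)) + real (card (B \<inter> contact))
      = real (card ((A \<union> B) \<inter> contact)) + real (card ((A \<inter> B) \<inter> contact))"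
    by (metis of_nat_add)
  then have "cS * real (card (A \<inter> contact)) + cS * real (card (B \<inter> contact))
      = cS * real (card ((A \<union> B) \<inter> contact)) + cS * real (card ((A \<inter> B) \<inter> contact))"
    by (metis distrib_left)
  ultimately show ?thesis by (simp add: surplus_def algebra_simps)
qed

lemma surplus_split:
  assumes A: "finite A" and U: "U \<subseteq> A"
    and sep: "\<And>x v. x \<in> U \<Longrightarrow> v \<in> directions \<Longrightarrow> x + v \<in> A \<Longrightarrow> x + v \<in> U"
  shows "surplus A = surplus U + surplus (A - U)"
proof -
  have "card ((U \<inter> contact) \<union> ((A - U) \<inter> contact)) = card (U \<inter> contact) + card ((A - U) \<inter> contact)"
    using A U by (intro card_Un_disjoint) (auto intro: finite_subset)
  moreover have "(U \<inter> contact) \<union> ((A - U) \<inter> contact) = A \<inter> contact" using U by auto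
  ultimately have "card (A \<inter> contact) = card (U \<inter> contact) + card ((A - U) \<inter> contact)" by simp
  then show ?thesis by (simp add: surplus_def deficiency_split[OF A U sep] algebra_simps)
qed

text \<open>
  The last atom of the highest row has at most three neighbours, so its removal does not
  increase the number of missing bonds; it costs no contact unless all atoms are in the bottom
  row. In that case one removes an atom without contact, which has at most two neighbours. If
  there is none, then an end atom loses its contact but had at most one neighbour for \<open>q = 1\<close>
  and none for \<open>q \<noteq> 1\<close>, and the dewetting condition is precisely what makes the removal
  favourable.
\<close>
lemma surplus_remove:
  assumes A: "finite A" "A \<noteq> {}" "\<forall>x\<in>A. 0 \<le> snd x"
  shows "\<exists>x\<in>A. surplus (A - {x}) \<le> surplus A"
proof -
  have cheap: "surplus (A - {x}) \<le> surplus A"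
    if x: "x \<in> A" and S: "{v \<in> directions. x + v \<in> A} \<subseteq> set vs"
      and gain: "cF * (2 * real (length vs) - 6) + cS * of_bool (x \<in> contact) \<le> 0" for x vs
  proof -
    have "card {v \<in> directions. x + v \<in> A} \<le> length vs"
      using S by (meson card_length card_mono finite_set le_trans)
    then have "real (deficiency (A - {x})) \<le> real (deficiency A) + (2 * real (length vs) - 6)"
      using deficiency_remove[OF A(1) x] by linarith
    then have "cF * real (deficiency (A - {x})) \<le> cF * (real (deficiency A) + (2 * real (length vs) - 6))"
      using cF_pos by (intro mult_left_mono) auto
    moreover have "real (card (A \<inter> contact)) \<le> real (card ((A - {x}) \<inter> contact)) + of_bool (x \<in> contact)"
    proof (cases "x \<in> contact")
      case True
      then have "(A - {x}) \<inter> contact = A \<inter> contact - {x}" by auto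
      then show ?thesis using A(1) x True card_Suc_Diff1[of "A \<inter> contact" x] by simp
    next
      case False
      then have "(A - {x}) \<inter> contact = A \<inter> contact" by auto
      then show ?thesis by simp
    qed
    then have "cS * real (card (A \<inter> contact))
        \<le> cS * (real (card ((A - {x}) \<inter> contact)) + of_bool (x \<in> contact))"
      using cS_pos by (intro mult_left_mono) auto
    ultimately show ?thesis using gain by (simp add: surplus_def algebra_simps)
  qed
  define h where "h = Max (snd ` A)"
  have "h \<in> snd ` A" unfolding h_def using A by (intro Max_in) auto
  then have row: "{x \<in> A. snd x = h} \<noteq> {}" by auto
  have h: "snd x \<le> h" if "x \<in> A" for x unfolding h_def using A that by (intro Max_ge) auto
  define r where "r = Max (fst ` {x \<in> A. snd x = h})"
  have "r \<in> fst ` {x \<in> A. snd x = h}" unfolding r_def using A row by (intro Max_in) auto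
  then have top: "(r, h) \<in> A" by auto
  have r: "i \<le> r" if "(i, h) \<in> A" for i
    unfolding r_def using A that by (intro Max_ge) (auto simp: image_iff intro!: bexI[of _ "(i, h)"])
  show ?thesis
  proof (cases "h = 0")
    case False
    have "surplus (A - {(r, h)}) \<le> surplus A"
    proof (rule cheap[where vs = "[(-1, 0), (0, -1), (1, -1)]"])
      show "{v \<in> directions. (r, h) + v \<in> A} \<subseteq> set [(-1, 0), (0, -1), (1, -1)]"
        using r[of "r + 1"] h by (force simp: directions_def)
    qed (use top False in \<open>auto simp: contact_def\<close>)
    then show ?thesis using top by blast
  next
    case h0: True
    have flat: "snd x = 0" if "x \<in> A" for x using A(3) h[OF that] that h0 by force
    have horizontal: "v = (1, 0) \<or> v = (-1, 0)" if "v \<in> directions" "x \<in> A" "x + v \<in> A" for x v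
      using flat[of x] flat[of "x + v"] that by (auto simp: directions_def)
    show ?thesis
    proof (cases "A \<subseteq> contact")
      case False
      then obtain x where x: "x \<in> A" "x \<notin> contact" by auto
      have "surplus (A - {x}) \<le> surplus A"
      proof (rule cheap[where vs = "[(-1, 0), (1, 0)]"])
        show "{v \<in> directions. x + v \<in> A} \<subseteq> set [(-1, 0), (1, 0)]"
          using horizontal[OF _ x(1)] by auto
      qed (use x cF_pos in auto)
      then show ?thesis using x by blast
    next
      case sub: True
      show ?thesis
      proof (cases "q = 1")
        case True
        have "surplus (A - {(r, h)}) \<le> surplus A"
        proof (rule cheap[where vs = "[(-1, 0)]"])
          show "{v \<in> directions. (r, h) + v \<in> A} \<subseteq> set [(-1, 0)]"
            using r[of "r + 1"] horizontal[OF _ top] by fastforce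
        qed (use top sub True weak_substrate in auto)
        then show ?thesis using top by blast
      next
        case False
        have "surplus (A - {(r, h)}) \<le> surplus A"
        proof (rule cheap[where vs = "[]"])
          show "{v \<in> directions. (r, h) + v \<in> A} \<subseteq> set []"
            using contact_neighbour[OF False, of "(r, h)"] sub top horizontal[OF _ top] by blast
        qed (use top sub False weak_substrate in auto)
        then show ?thesis using top by blast
      qed
    qed
  qed
qed

text \<open>
  There are infinitely many shapes of given size, but only finitely many values of the surplus,
  as the two cardinalities in it are bounded. So the minimum exists.
\<close>
lemma finite_surplus_shapes: "finite (surplus ` shapes m)"
proof -
  have "surplus ` shapes m \<subseteq> (\<lambda>(d, w). cF * real d - cS * real w) ` ({..6 * m} \<times> {..m})"
  proof
    fix y assume "y \<in> surplus ` shapes m"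
    then obtain A where A: "finite A" "card A = m" "y = surplus A" by (auto simp: shapes_def)
    have "card (exposed A v) \<le> m" for v
      unfolding A(2)[symmetric] using A(1) by (intro card_mono) (auto simp: exposed_def)
    then have "deficiency A \<le> of_nat (card directions) * m"
      unfolding deficiency_def by (intro sum_bounded_above) auto
    moreover have "card (A \<inter> contact) \<le> m" unfolding A(2)[symmetric] using A(1) by (intro card_mono) auto
    ultimately show "y \<in> (\<lambda>(d, w). cF * real d - cS * real w) ` ({..6 * m} \<times> {..m})"
      by (intro image_eqI[of _ _ "(deficiency A, card (A \<inter> contact))"]) (auto simp: A(3) surplus_def)
  qed
  then show ?thesis by (rule finite_subset) auto
qed

lemma shapes_nonempty: "shapes m \<noteq> {}"
proof -
  have "(\<lambda>i. (int i, 0)) ` {..<m} \<in> shapes m"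
    by (auto simp: shapes_def card_image inj_on_def)
  then show ?thesis by blast
qed

lemma least_surplus_le:
  assumes "A \<in> shapes m"
  shows "least_surplus m \<le> surplus A"
  unfolding least_surplus_def using assms finite_surplus_shapes by (intro Min_le) auto

lemma least_surplus_attained:
  obtains A where "A \<in> shapes m" "surplus A = least_surplus m"
proof -
  have "least_surplus m \<in> surplus ` shapes m"
    unfolding least_surplus_def using shapes_nonempty finite_surplus_shapes by (intro Min_in) auto
  then show ?thesis using that by auto
qed

lemma least_surplus_mono: "m \<le> n \<Longrightarrow> least_surplus m \<le> least_surplus n"
proof (induction n rule: dec_induct)
  case (step n)
  obtain A where A: "A \<in> shapes (Suc n)" "surplus A = least_surplus (Suc n)"
    by (rule least_surplus_attained)
  then have "finite A" "A \<noteq> {}" "\<forall>x\<in>A. 0 \<le> snd x" by (auto simp: shapes_def)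
  then obtain x where x: "x \<in> A" "surplus (A - {x}) \<le> surplus A"
    using surplus_remove by blast
  have "A - {x} \<in> shapes n" using A x by (auto simp: shapes_def)
  then show ?case using least_surplus_le[of "A - {x}" n] A x step by simp
qed simp

lemma least_surplus_lower: "coercivity * sqrt (real m) \<le> least_surplus m"
proof -
  obtain A where A: "A \<in> shapes m" "surplus A = least_surplus m" by (rule least_surplus_attained)
  have "coercivity * sqrt (real m) \<le> coercivity * real (deficiency A)"
    using A coercivity_pos sqrt_card_le_deficiency[of A] by (intro mult_left_mono) (auto simp: shapes_def)
  also have "\<dots> \<le> least_surplus m"
    using A deficiency_le_surplus[of A] by (simp add: shapes_def)
  finally show ?thesis .
qed

text \<open>
  By monotonicity it suffices to consider a rhombus of side \<open>\<lceil>\<surd>m\<rceil>\<close>.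
\<close>
lemma least_surplus_upper: "least_surplus m \<le> 48 * cF * sqrt (real m)"
proof (cases "m = 0")
  case True
  have "{} \<in> shapes 0" by (simp add: shapes_def)
  then show ?thesis
    using True least_surplus_le[of "{}" 0] by simp
next
  case False
  define k where "k = nat \<lceil>sqrt (real m)\<rceil>"
  have k: "sqrt (real m) \<le> real k" "real k \<le> sqrt (real m) + 1"
    unfolding k_def using real_sqrt_ge_zero[of "real m"] by linarith+
  have "1 \<le> sqrt (real m)" using False by simp
  then have k2: "real k \<le> 2 * sqrt (real m)" using k by linarith
  have "real m \<le> (real k)\<^sup>2" using k(1) by (rule sqrt_le_D)
  then have "m \<le> k\<^sup>2" by (metis of_nat_le_iff of_nat_power)
  then have "least_surplus m \<le> least_surplus (k\<^sup>2)" by (rule least_surplus_mono)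
  also have "\<dots> \<le> surplus ({0..<int k} \<times> {0..<int k})"
    by (rule least_surplus_le) (auto simp: shapes_def power2_eq_square)
  also have "\<dots> \<le> cF * real (deficiency ({0..<int k} \<times> {0..<int k}))"
    using cS_pos by (simp add: surplus_def)
  also have "\<dots> \<le> cF * (24 * (2 * sqrt (real m)))"
  proof (intro mult_left_mono)
    have "real (deficiency ({0..<int k} \<times> {0..<int k})) \<le> real (24 * k)"
      using deficiency_square_le by (rule of_nat_mono)
    then show "real (deficiency ({0..<int k} \<times> {0..<int k})) \<le> 24 * (2 * sqrt (real m))"
      using k2 by simp
  qed (use cF_pos in simp)
  finally show ?thesis by (simp add: algebra_simps)
qed

text \<open>
  Two minimisers can be moved apart along the substrate without changing their surplus.
\<close>
lemma least_surplus_subadditive: "least_surplus (m + n) \<le> least_surplus m + least_surplus n"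
proof -
  obtain A where A: "A \<in> shapes m" "surplus A = least_surplus m" by (rule least_surplus_attained)
  obtain B where B: "B \<in> shapes n" "surplus B = least_surplus n" by (rule least_surplus_attained)
  have fin: "finite A" "finite B" using A B by (auto simp: shapes_def)
  obtain k :: nat where k: "A \<inter> (+) (int (k * q), 0) ` B = {}"
    using disjoint_translate[OF fin q_pos] .
  let ?B = "(+) (int (k * q), 0) ` B"
  have "A \<union> ?B \<in> shapes (m + n)"
    using A B k fin by (auto simp: shapes_def card_Un_disjoint card_image)
  then have "least_surplus (m + n) \<le> surplus (A \<union> ?B)" by (rule least_surplus_le)
  also have "\<dots> \<le> surplus A + surplus ?B"
    using surplus_submodular[of A ?B] fin k by simp
  finally show ?thesis using A B by (simp add: surplus_translate)
qed

text \<open>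
  Slide a copy of a minimiser \<open>A\<close> away from \<open>A\<close> until their overlap first drops to at most \<open>a -
  d\<close>. One step lowers the overlap by at most \<open>q\<close> times the number of missing bonds of \<open>A\<close>,
  which is of order \<open>\<surd>a\<close>. So the overlap falls short of \<open>a - d\<close> by some \<open>t\<close> of that order, and
  it is completed by \<open>t\<close> further atoms at a cost of order \<open>\<surd>t\<close>, that is \<open>a\<^bsup>1/4\<^esup>\<close>. The union has
  at least \<open>a + d\<close> atoms, which monotonicity turns into a bound for exactly \<open>a + d\<close> atoms.
\<close>
lemma least_surplus_approx_concave:
  assumes "d \<le> a"
  shows "least_surplus (a + d) + least_surplus (a - d)
    \<le> 2 * least_surplus a + 48 * cF * sqrt (real q * (48 * cF / coercivity)) * sqrt (sqrt (real a))"
proof -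
  obtain A where A: "A \<in> shapes a" "surplus A = least_surplus a" by (rule least_surplus_attained)
  have fin: "finite A" and cA: "card A = a" and nn: "\<forall>x\<in>A. 0 \<le> snd x"
    using A by (auto simp: shapes_def)
  let ?T = "\<lambda>k. (+) (int (k * q), 0 :: int) ` A"
  define ov where "ov k = card (A \<inter> ?T k)" for k
  define J where "J = q * deficiency A"
  have jump: "ov k \<le> ov (Suc k) + J" for k
  proof -
    have eq: "?T (Suc k) = (+) (int (k * q), 0) ` (+) (int q, 0) ` A"
      by (simp add: image_image add.assoc[symmetric] algebra_simps)
    have "?T k - ?T (Suc k) = (+) (int (k * q), 0) ` (A - (+) (int q, 0) ` A)"
      unfolding eq by (simp add: image_set_diff)
    then have "card (?T k - ?T (Suc k)) \<le> q * card (exposed A (-1, 0))"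
      using card_shift_diff_le[OF fin, of q] by (simp add: card_image)
    also have "\<dots> \<le> J" by (simp add: J_def deficiency_eq)
    finally have "card (?T k - ?T (Suc k)) \<le> J" .
    moreover have "ov k \<le> ov (Suc k) + card (?T k - ?T (Suc k))"
      unfolding ov_def using fin by (intro order_trans[OF card_mono card_Un_le]) auto
    ultimately show ?thesis by simp
  qed
  obtain k0 where "ov k0 = 0"
    using disjoint_translate[OF fin fin q_pos] by (metis card.empty ov_def)
  \<comment> \<open>The first step at which the overlap is small enough; the step before it bounds the shortfall.\<close>
  define k where "k = (LEAST k. ov k \<le> a - d)"
  have k: "ov k \<le> a - d" unfolding k_def by (rule LeastI[of _ k0]) (simp add: \<open>ov k0 = 0\<close>)
  have reach: "a - d \<le> ov k + J"
  proof (cases k)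
    case 0
    then show ?thesis by (simp add: ov_def cA zero_prod_def[symmetric])
  next
    case (Suc j)
    then have "\<not> ov j \<le> a - d" unfolding k_def by (intro not_less_Least) simp
    then show ?thesis using jump[of j] Suc by simp
  qed
  define t where "t = a - d - ov k"
  have t: "t \<le> J" "ov k + t = a - d" using k reach by (auto simp: t_def)
  have cU: "card (A \<union> ?T k) + ov k = 2 * a"
    unfolding ov_def using fin card_Un_Int[of A "?T k"] by (simp add: cA card_image)
  have "A \<union> ?T k \<in> shapes (card (A \<union> ?T k))" "A \<inter> ?T k \<in> shapes (ov k)"
    using fin nn by (auto simp: shapes_def ov_def)
  then have "least_surplus (card (A \<union> ?T k)) + least_surplus (ov k) \<le> surplus A + surplus (?T k)"
    using surplus_submodular[of A "?T k"] fin least_surplus_le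
    by (smt (verit, ccfv_threshold) finite_imageI)
  then have sub: "least_surplus (card (A \<union> ?T k)) + least_surplus (ov k) \<le> 2 * least_surplus a"
    using A by (simp add: surplus_translate)
  have "least_surplus (a + d) \<le> least_surplus (card (A \<union> ?T k))"
    using cU k assms by (intro least_surplus_mono) simp
  moreover have "least_surplus (a - d) \<le> least_surplus (ov k) + least_surplus t"
    using least_surplus_subadditive[of "ov k" t] t by simp
  moreover have "least_surplus t \<le> 48 * cF * sqrt (real q * (48 * cF / coercivity)) * sqrt (sqrt (real a))"
  proof -
    have "coercivity * real (deficiency A) \<le> 48 * cF * sqrt (real a)"
      using deficiency_le_surplus[OF fin nn] least_surplus_upper[of a] A by simp
    then have "real (deficiency A) \<le> 48 * cF / coercivity * sqrt (real a)"
      using coercivity_pos by (simp add: field_simps)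
    then have "real q * real (deficiency A) \<le> real q * (48 * cF / coercivity * sqrt (real a))"
      by (intro mult_left_mono) auto
    moreover have "real t \<le> real q * real (deficiency A)"
      using t(1) unfolding J_def by (metis of_nat_le_iff of_nat_mult)
    ultimately have "real t \<le> real q * (48 * cF / coercivity) * sqrt (real a)"
      by (simp add: mult.assoc)
    then have "sqrt (real t) \<le> sqrt (real q * (48 * cF / coercivity) * sqrt (real a))"
      by (rule real_sqrt_le_mono)
    also have "\<dots> = sqrt (real q * (48 * cF / coercivity)) * sqrt (sqrt (real a))"
      by (rule real_sqrt_mult)
    finally have "48 * cF * sqrt (real t)
        \<le> 48 * cF * (sqrt (real q * (48 * cF / coercivity)) * sqrt (sqrt (real a)))"
      using cF_pos by (intro mult_left_mono) auto
    then show ?thesis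
      using least_surplus_upper[of t] by (simp only: mult.assoc)
  qed
  ultimately show ?thesis using sub by linarith
qed

lemma separated_part_is_lopsided:
  assumes eps: "0 < \<epsilon>"
  obtains N where "\<And>n A U. N \<le> n \<Longrightarrow> A \<in> shapes n \<Longrightarrow> surplus A = least_surplus n \<Longrightarrow> U \<subseteq> A \<Longrightarrow>
      (\<And>x v. x \<in> U \<Longrightarrow> v \<in> directions \<Longrightarrow> x + v \<in> A \<Longrightarrow> x + v \<in> U) \<Longrightarrow>
      real (card U) < \<epsilon> * real n \<or> (1 - \<epsilon>) * real n < real (card U)"
proof -
  have "0 \<le> 48 * cF * sqrt (real q * (48 * cF / coercivity))" using cF_pos coercivity_pos by simp
  from exact_splitting_is_lopsided[OF coercivity_pos this least_surplus_lower least_surplus_upper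
      least_surplus_approx_concave eps]
  obtain N where N: "\<And>n a. N \<le> n \<Longrightarrow> a \<le> n \<Longrightarrow>
      least_surplus a + least_surplus (n - a) \<le> least_surplus n \<Longrightarrow>
      real a < \<epsilon> * real n \<or> (1 - \<epsilon>) * real n < real a" by blast
  show thesis
  proof (rule that[OF N])
    fix n A U
    assume A: "A \<in> shapes n" "surplus A = least_surplus n" and U: "U \<subseteq> A"
      and sep: "\<And>x v. x \<in> U \<Longrightarrow> v \<in> directions \<Longrightarrow> x + v \<in> A \<Longrightarrow> x + v \<in> U"
    have fin: "finite A" "finite U" using A U by (auto simp: shapes_def intro: finite_subset)
    show "card U \<le> n" using A U by (auto simp: shapes_def intro: card_mono)
    have "U \<in> shapes (card U)" "A - U \<in> shapes (n - card U)"
      using A U fin by (auto simp: shapes_def card_Diff_subset)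
    then show "least_surplus (card U) + least_surplus (n - card U) \<le> least_surplus n"
      using surplus_split[OF fin(1) U sep] A(2) least_surplus_le by (metis add_mono)
  qed
qed

end

section \<open>From lattice coordinates to the configurations\<close>

definition site :: "real \<Rightarrow> int \<times> int \<Rightarrow> real \<times> real" where
  "site eS k = (0, eS) + of_int (fst k) *\<^sub>R t1 + of_int (snd k) *\<^sub>R t2"

lemma film_lattice_eq: "film_lattice eS = site eS ` {k. 0 \<le> snd k}"
proof (intro equalityI subsetI)
  fix x assume "x \<in> film_lattice eS"
  then obtain i :: int and j :: nat where "x = site eS (i, int j)"
    by (auto simp: film_lattice_def site_def)
  then show "x \<in> site eS ` {k. 0 \<le> snd k}" by auto
next
  fix x assume "x \<in> site eS ` {k. 0 \<le> snd k}"
  then obtain k where k: "0 \<le> snd k" "x = site eS k" by auto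
  then have "x = (0, eS) + of_int (fst k) *\<^sub>R t1 + of_nat (nat (snd k)) *\<^sub>R t2"
    by (simp add: site_def)
  then show "x \<in> film_lattice eS" unfolding film_lattice_def by blast
qed

text \<open>
  This is the norm form of the triangular lattice. Its six vectors of norm one are the
  directions, and all other nonzero vectors are longer, so the potential between film atoms only
  sees bonds.
\<close>
lemma dist_site_square:
  "(dist (site eS k) (site eS (k + v)))\<^sup>2 = of_int ((fst v)\<^sup>2 + fst v * snd v + (snd v)\<^sup>2)"
proof -
  have "(dist (site eS k) (site eS (k + v)))\<^sup>2
      = (of_int (fst v) + of_int (snd v) / 2)\<^sup>2 + (of_int (snd v) * sqrt 3 / 2)\<^sup>2"
    by (simp add: site_def t1_def t2_def dist_Pair_Pair dist_real_def algebra_simps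
        add_divide_distrib) (simp add: power2_eq_square algebra_simps)
  also have "\<dots> = of_int ((fst v)\<^sup>2 + fst v * snd v + (snd v)\<^sup>2)"
    by (simp add: power_mult_distrib power_divide power2_eq_square algebra_simps)
  finally show ?thesis .
qed

lemma quadratic_form_eq_1_iff:
  fixes v :: "int \<times> int"
  shows "(fst v)\<^sup>2 + fst v * snd v + (snd v)\<^sup>2 = 1 \<longleftrightarrow> v \<in> directions"
proof
  obtain a b where v: "v = (a, b)" by force
  assume "(fst v)\<^sup>2 + fst v * snd v + (snd v)\<^sup>2 = 1"
  then have eq: "a\<^sup>2 + a * b + b\<^sup>2 = 1" by (simp add: v)
  have "3 * b\<^sup>2 = 4 - (2 * a + b)\<^sup>2" "3 * a\<^sup>2 = 4 - (2 * b + a)\<^sup>2" using eq by algebra+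
  then have "3 * b\<^sup>2 \<le> 4" "3 * a\<^sup>2 \<le> 4" by simp_all
  then have "a\<^sup>2 \<le> 1" "b\<^sup>2 \<le> 1" by linarith+
  then have "\<bar>a\<bar> \<le> 1" "\<bar>b\<bar> \<le> 1" by (simp_all add: abs_square_le_1)
  then have "a \<in> {-1, 0, 1}" "b \<in> {-1, 0, 1}" by auto
  then show "v \<in> directions" using eq by (auto simp: v directions_def)
qed (auto simp: directions_def)

lemma dist_site_eq_1_iff: "dist (site eS k) (site eS (k + v)) = 1 \<longleftrightarrow> v \<in> directions"
proof -
  have "dist (site eS k) (site eS (k + v)) = 1 \<longleftrightarrow> (dist (site eS k) (site eS (k + v)))\<^sup>2 = 1"
    by (metis one_power2 power2_eq_iff_nonneg zero_le_dist zero_le_one)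
  also have "\<dots> \<longleftrightarrow> v \<in> directions"
    unfolding dist_site_square quadratic_form_eq_1_iff[symmetric] by linarith
  finally show ?thesis .
qed

lemma dist_site_ge_1:
  assumes "v \<noteq> 0"
  shows "1 \<le> dist (site eS k) (site eS (k + v))"
proof -
  obtain a b where v: "v = (a, b)" by force
  have "4 * (a\<^sup>2 + a * b + b\<^sup>2) = (2 * a + b)\<^sup>2 + 3 * b\<^sup>2" by algebra
  moreover have "0 < (2 * a + b)\<^sup>2 + 3 * b\<^sup>2"
  proof (cases "b = 0")
    case True
    then show ?thesis using assms by (simp add: v zero_prod_def)
  next
    case False
    then have "0 < b\<^sup>2" by simp
    then show ?thesis using zero_le_power2[of "2 * a + b"] by linarith
  qed
  ultimately have "1 \<le> (fst v)\<^sup>2 + fst v * snd v + (snd v)\<^sup>2" by (simp add: v)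
  then have "1 \<le> (dist (site eS k) (site eS (k + v)))\<^sup>2"
    unfolding dist_site_square by (simp only: of_int_1_le_iff)
  then show ?thesis using power2_le_imp_le[of 1 "dist (site eS k) (site eS (k + v))"] by simp
qed

lemma inj_site: "inj (site eS)"
proof (rule injI)
  fix k l assume "site eS k = site eS l"
  then show "k = l" using dist_site_ge_1[of "l - k" eS k] by (cases "l - k = 0") auto
qed

text \<open>
  A bond is counted in both orientations here, as in the film-film part of the energy.
\<close>
lemma card_bonds_site:
  assumes A: "finite A"
  shows "card (bonds (site eS ` A)) + deficiency A = 6 * card A"
proof -
  let ?b = "\<lambda>(v, x). (site eS x, site eS (x + v))"
  let ?S = "SIGMA v:directions. {x \<in> A. x + v \<in> A}"
  have "bonds (site eS ` A) = ?b ` ?S"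
  proof (intro equalityI subsetI)
    fix z assume "z \<in> bonds (site eS ` A)"
    then obtain x y where xy: "x \<in> A" "y \<in> A" "z = (site eS x, site eS y)"
        "dist (site eS x) (site eS y) = 1" by (auto simp: bonds_def)
    then have "y - x \<in> directions" using dist_site_eq_1_iff[of eS x "y - x"] by simp
    then show "z \<in> ?b ` ?S" using xy by (intro image_eqI[of _ _ "(y - x, x)"]) auto
  next
    fix z assume "z \<in> ?b ` ?S"
    then obtain v x where "z = (site eS x, site eS (x + v))" "v \<in> directions" "x \<in> A" "x + v \<in> A"
      by auto
    then show "z \<in> bonds (site eS ` A)" using dist_site_eq_1_iff[of eS x v] by (simp add: bonds_def)
  qed
  moreover have "inj_on ?b ?S"
    by (rule inj_onI) (auto dest!: injD[OF inj_site])
  ultimately have "card (bonds (site eS ` A)) = (\<Sum>v\<in>directions. card {x \<in> A. x + v \<in> A})"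
    using A by (simp add: card_image)
  moreover have "card {x \<in> A. x + v \<in> A} + card (exposed A v) = card A" for v
    using A unfolding exposed_def
    by (subst card_Un_disjoint[symmetric]) (auto intro!: arg_cong[where f = card])
  then have "(\<Sum>v\<in>directions. card {x \<in> A. x + v \<in> A} + card (exposed A v)) = 6 * card A" by simp
  ultimately show ?thesis by (simp add: deficiency_def sum.distrib)
qed

lemma film_interaction:
  assumes A: "finite A"
  shows "(\<Sum>(x, y) \<in> {(x, y) \<in> site eS ` A \<times> site eS ` A. x \<noteq> y}. sticky_potential 1 cF (dist x y))
    = ereal (cF * real (deficiency A) - 6 * cF * real (card A))" (is "sum ?g ?P = _")
proof -
  have fin: "finite ?P" using A by (auto intro: finite_subset[of _ "site eS ` A \<times> site eS ` A"])
  have "sum ?g ?P = (\<Sum>z\<in>?P. ereal (if z \<in> bonds (site eS ` A) then - cF else 0))"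
  proof (rule sum.cong[OF refl])
    fix z assume "z \<in> ?P"
    then obtain x y where xy: "z = (site eS x, site eS y)" "x \<in> A" "y \<in> A" "x \<noteq> y" by blast
    then have "1 \<le> dist (site eS x) (site eS y)" using dist_site_ge_1[of "y - x" eS x] by simp
    then show "?g z = ereal (if z \<in> bonds (site eS ` A) then - cF else 0)"
      using xy by (auto simp: sticky_potential_def bonds_def)
  qed
  also have "\<dots> = ereal (\<Sum>z\<in>?P. if z \<in> bonds (site eS ` A) then - cF else 0)" by (rule sum_ereal)
  also have "(\<Sum>z\<in>?P. if z \<in> bonds (site eS ` A) then - cF else 0)
      = - cF * real (card (bonds (site eS ` A)))"
  proof -
    have "?P \<inter> bonds (site eS ` A) = bonds (site eS ` A)" by (auto simp: bonds_def)
    then show ?thesis using fin by (simp add: sum.If_cases Collect_mem_eq)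
  qed
  also have "real (card (bonds (site eS ` A))) = 6 * real (card A) - real (deficiency A)"
    using card_bonds_site[OF A, of eS] by linarith
  finally show ?thesis by (simp add: algebra_simps)
qed

context dewetting
begin

text \<open>
  The substrate sites have spacing \<open>q / p\<close> and the film sites spacing \<open>1\<close>. As \<open>p\<close> and \<open>q\<close> are
  coprime, the film site \<open>k\<^sub>1\<close> is above a substrate site exactly when \<open>q\<close> divides \<open>k\<^sub>1\<close>.
\<close>
lemma site_contact_iff:
  assumes p: "1 \<le> p" and cop: "coprime p q" and eS: "eS = real q / real p"
    and bd: "LS \<inter> (UNIV \<times> {0}) = {(of_int k * eS, 0) | k::int. True}"
  shows "site eS k \<in> {(0, eS) + of_int i *\<^sub>R t1 | i::int. True}
      \<inter> (\<lambda>s. s + eS *\<^sub>R (0, 1)) ` (LS \<inter> (UNIV \<times> {0})) \<longleftrightarrow> k \<in> contact"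
proof -
  have site: "site eS k = (of_int (fst k) + of_int (snd k) / 2, eS + of_int (snd k) * sqrt 3 / 2)"
    by (simp add: site_def t1_def t2_def)
  have "site eS k \<in> {(0, eS) + of_int i *\<^sub>R t1 | i::int. True} \<longleftrightarrow> snd k = 0"
    unfolding site by (auto simp: t1_def)
  moreover have "site eS k \<in> (\<lambda>s. s + eS *\<^sub>R (0, 1)) ` (LS \<inter> (UNIV \<times> {0})) \<longleftrightarrow> int q dvd fst k"
    if "snd k = 0"
  proof -
    have "site eS k \<in> (\<lambda>s. s + eS *\<^sub>R (0, 1)) ` (LS \<inter> (UNIV \<times> {0}))
        \<longleftrightarrow> (\<exists>i::int. real_of_int (fst k) = of_int i * eS)"
      unfolding bd site using that by (auto simp: image_iff)
    also have "\<dots> \<longleftrightarrow> (\<exists>i::int. fst k * int p = i * int q)"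
    proof -
      have "real_of_int (fst k) = of_int i * eS \<longleftrightarrow> real_of_int (fst k * int p) = real_of_int (i * int q)" for i
        using p by (simp add: eS field_simps)
      then show ?thesis by (simp only: of_int_eq_iff)
    qed
    also have "\<dots> \<longleftrightarrow> int q dvd fst k * int p" by (auto simp: dvd_def mult.commute)
    also have "\<dots> \<longleftrightarrow> int q dvd fst k"
      using cop by (simp add: coprime_dvd_mult_left_iff coprime_commute)
    finally show ?thesis .
  qed
  ultimately show ?thesis by (auto simp: contact_def)
qed

lemma energy_site:
  assumes p: "1 \<le> p" and cop: "coprime p q" and eS: "eS = real q / real p"
    and sub: "LS \<subseteq> closure substrate_region"
    and bd: "LS \<inter> (UNIV \<times> {0}) = {(of_int k * eS, 0) | k::int. True}"
    and A: "A \<in> shapes n"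
  shows "energy eS cF cS LS (site eS ` A) = ereal (surplus A - 6 * cF * real n)"
proof -
  have fin: "finite A" and cA: "card A = n" and nn: "\<And>k. k \<in> A \<Longrightarrow> 0 \<le> snd k"
    using A by (auto simp: shapes_def)
  have eS_pos: "0 < eS" using eS p q_pos by simp
  have "(\<Sum>x\<in>site eS ` A. substrate_potential eS cS LS x)
      = (\<Sum>k\<in>A. substrate_potential eS cS LS (site eS k))"
    by (subst sum.reindex) (auto intro: inj_on_subset[OF inj_site])
  also have "\<dots> = (\<Sum>k\<in>A. ereal (if k \<in> contact then - cS else 0))"
  proof (rule sum.cong[OF refl])
    fix k assume "k \<in> A"
    then have "site eS k \<in> film_lattice eS" using nn by (auto simp: film_lattice_eq)
    then show "substrate_potential eS cS LS (site eS k) = ereal (if k \<in> contact then - cS else 0)"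
      by (subst substrate_potential_film_lattice[OF eS_pos sub bd])
        (simp_all only: site_contact_iff[OF p cop eS bd], auto)
  qed
  also have "\<dots> = ereal (- cS * real (card (A \<inter> contact)))"
    using fin by (simp add: sum.If_cases)
  finally show ?thesis
    unfolding energy_def film_interaction[OF fin] by (simp add: surplus_def cA algebra_simps)
qed

lemma shape_of_minimizer:
  assumes p: "1 \<le> p" and cop: "coprime p q" and eS: "eS = real q / real p"
    and sub: "LS \<subseteq> closure substrate_region"
    and bd: "LS \<inter> (UNIV \<times> {0}) = {(of_int k * eS, 0) | k::int. True}"
    and min: "is_arg_min (energy eS cF cS LS) (\<lambda>C. C \<in> configurations eS n) D"
  obtains A where "A \<in> shapes n" "D = site eS ` A" "surplus A = least_surplus n"
proof -
  have D: "D \<subseteq> site eS ` {k. 0 \<le> snd k}" "finite D" "card D = n"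
    using min by (auto simp: is_arg_min_def configurations_def film_lattice_eq)
  then obtain A where A: "A \<subseteq> {k. 0 \<le> snd k}" "D = site eS ` A" by (auto simp: subset_image_iff)
  have inj: "inj_on (site eS) B" for B by (rule inj_on_subset[OF inj_site]) simp
  have "A \<in> shapes n"
    using A D inj by (auto simp: shapes_def card_image finite_image_iff)
  moreover have "surplus A \<le> surplus B" if B: "B \<in> shapes n" for B
  proof -
    have "site eS ` B \<in> configurations eS n"
      using B inj by (auto simp: configurations_def film_lattice_eq shapes_def card_image)
    then have "\<not> energy eS cF cS LS (site eS ` B) < energy eS cF cS LS D"
      using min by (auto simp: is_arg_min_def)
    then show ?thesis
      unfolding A(2) energy_site[OF p cop eS sub bd B] energy_site[OF p cop eS sub bd \<open>A \<in> shapes n\<close>]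
      by simp
  qed
  then have "surplus A = least_surplus n"
    using least_surplus_attained[of n] least_surplus_le[OF \<open>A \<in> shapes n\<close>] by (metis order_antisym)
  ultimately show ?thesis using A(2) that by blast
qed

end

lemma sym_bonds: "sym (bonds D)"
  by (auto simp: bonds_def sym_def dist_commute)

text \<open>
  If the largest component had fewer than \<open>\<epsilon> n\<close> atoms, take a union of components that is
  smallest among those with at least \<open>\<epsilon> n\<close> atoms. Without one of its components it has fewer
  than \<open>\<epsilon> n\<close> atoms, so it has fewer than \<open>2 \<epsilon> n \<le> (1 - \<epsilon>) n\<close>, a size that is excluded. Unions of
  components appear as sets closed under bonds.
\<close>
lemma largest_component_dominates:
  assumes D: "finite D" "card D = n" "0 < n" and eps: "0 < \<epsilon>" "\<epsilon> \<le> 1 / 3"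
    and lopsided: "\<And>U. U \<subseteq> D \<Longrightarrow> bonds D `` U \<subseteq> U \<Longrightarrow>
      real (card U) < \<epsilon> * real n \<or> (1 - \<epsilon>) * real n < real (card U)"
    and largest: "is_arg_max card (\<lambda>C. C \<in> bond_components D) K"
  shows "(1 - \<epsilon>) * real n < real (card K)" "K \<subseteq> D"
proof -
  have component: "C \<subseteq> D \<and> bonds D `` C \<subseteq> C" if C: "C \<in> bond_components D" for C
  proof -
    obtain x where x: "x \<in> D" "C = (bonds D)\<^sup>* `` {x}" using C by (auto simp: bond_components_def)
    have "y \<in> D" if "(x, y) \<in> (bonds D)\<^sup>*" for y
      using that x(1) by (induction rule: rtrancl_induct) (auto simp: bonds_def)
    then show ?thesis using x by (auto intro: rtrancl_into_rtrancl)
  qed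
  have K: "K \<in> bond_components D" "\<And>C. C \<in> bond_components D \<Longrightarrow> card C \<le> card K"
    using largest by (auto simp: is_arg_max_def not_less)
  then show "K \<subseteq> D" using component by blast
  show "(1 - \<epsilon>) * real n < real (card K)"
  proof (rule ccontr)
    assume "\<not> ?thesis"
    then have small: "real (card K) < \<epsilon> * real n" using lopsided[of K] component[OF K(1)] by blast
    let ?Q = "\<lambda>U. U \<subseteq> D \<and> bonds D `` U \<subseteq> U \<and> \<epsilon> * real n \<le> real (card U)"
    have "\<epsilon> * real n \<le> 1 * real n" using eps by (intro mult_right_mono) auto
    then have "?Q D" using D by (auto simp: bonds_def)
    then obtain U where U: "?Q U" and least: "\<And>V. ?Q V \<Longrightarrow> card U \<le> card V"
      using ex_has_least_nat[of ?Q D card] by blast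
    have "0 < \<epsilon> * real n" using eps D by simp
    then have "U \<noteq> {}" using U by auto
    then obtain x where x: "x \<in> U" by blast
    define C where "C = (bonds D)\<^sup>* `` {x}"
    have C: "C \<in> bond_components D" using x U unfolding C_def bond_components_def by blast
    have "y \<in> U" if "(x, y) \<in> (bonds D)\<^sup>*" for y
      using that x U by (induction rule: rtrancl_induct) auto
    then have CU: "C \<subseteq> U" by (auto simp: C_def)
    have finU: "finite U" using U D finite_subset by blast
    have "bonds D `` (U - C) \<subseteq> U - C"
    proof
      fix z assume "z \<in> bonds D `` (U - C)"
      then obtain y where y: "y \<in> U" "y \<notin> C" "(y, z) \<in> bonds D" by auto
      then have "(z, y) \<in> bonds D" using sym_bonds by (auto dest: symD)
      then show "z \<in> U - C" using y U component[OF C] by blast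
    qed
    moreover have "card (U - C) < card U"
      using x finU by (intro psubset_card_mono) (auto simp: C_def)
    moreover have "U - C \<subseteq> D" using U by blast
    ultimately have "real (card (U - C)) < \<epsilon> * real n"
      using least[of "U - C"] by (meson leD not_le_imp_less)
    moreover have "card U = card (U - C) + card C"
      using card_Diff_subset[of C U] CU finU by (metis card_mono finite_subset le_add_diff_inverse2)
    ultimately have "real (card U) < 2 * \<epsilon> * real n" using K(2)[OF C] small by simp
    also have "\<dots> \<le> (1 - \<epsilon>) * real n" using eps by (intro mult_right_mono) auto
    finally show False using lopsided[of U] U by auto
  qed
qed

lemma measure_empirical_measure_rescale:
  assumes D: "finite D" "card D = n" "0 < n" and K: "K \<subseteq> D"
  shows "measure (empirical_measure D) (rescale n ` K) = real (card K) / real n"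
proof -
  have fin: "finite K" using D K by (auto intro: finite_subset)
  have inj: "inj (rescale n)" using D by (auto simp: rescale_def inj_on_def)
  have "(\<Sum>x\<in>D. emeasure (return borel (rescale n x)) (rescale n ` K))
      = (\<Sum>x\<in>D. of_bool (x \<in> K) :: ennreal)"
    using fin inj by (intro sum.cong refl) (auto simp: indicator_def inj_image_mem_iff borel_closed finite_imp_closed)
  also have "\<dots> = of_nat (card K)" using D K by (simp add: Int_absorb1)
  finally have "emeasure (empirical_measure D) (rescale n ` K) = of_nat (card K) / of_nat n"
    using D fin by (subst emeasure_empirical_measure) (auto simp: borel_closed finite_imp_closed)
  also have "\<dots> = ennreal (real (card K) / real n)"
    using D by (simp add: ennreal_of_nat_eq_real_of_nat divide_ennreal)
  finally show ?thesis by (simp add: measure_def)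
qed

theorem theorem2p3:
  fixes p q :: nat and cF cS eS :: real
    and LS :: "(real \<times> real) set"
    and D D1 :: "nat \<Rightarrow> (real \<times> real) set"
  assumes "p \<ge> 1" and "q \<ge> 1" and "coprime p q"
    and "eS = real q / real p"
    and "cF > 0" and "cS > 0"
    and "lattice_in (closure substrate_region) LS"
    and "LS \<inter> (UNIV \<times> {0}) = {(of_int k * eS, 0) | k::int. True}"
    and dewetting: "if q \<noteq> 1 then cS < 6 * cF else cS < 4 * cF"
    and minimizer: "\<And>n. n \<ge> 1 \<Longrightarrow>
      is_arg_min (energy eS cF cS LS) (\<lambda>C. C \<in> configurations eS n) (D n)"
    and largest_component: "\<And>n. n \<ge> 1 \<Longrightarrow>
      is_arg_max card (\<lambda>C. C \<in> bond_components (D n)) (D1 n)"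
  shows "(\<lambda>n. measure (empirical_measure (D n)) (rescale n ` D1 n)) \<longlonglongrightarrow> 1 \<and>
         (\<lambda>n. real (card (D1 n)) / real n) \<longlonglongrightarrow> 1"
proof -
  interpret dewetting q cF cS by standard (use assms in auto)
  have sub: "LS \<subseteq> closure substrate_region" using assms(7) by (auto simp: lattice_in_def)
  have D: "finite (D n)" "card (D n) = n" if "1 \<le> n" for n
    using minimizer[OF that] by (auto simp: is_arg_min_def configurations_def)
  have eventually_large: "\<exists>N\<ge>1. \<forall>n\<ge>N. D1 n \<subseteq> D n \<and> (1 - \<epsilon>) * real n < real (card (D1 n))"
    if eps: "0 < \<epsilon>" "\<epsilon> \<le> 1 / 3" for \<epsilon>
  proof -
    obtain N where N: "\<And>n A U. N \<le> n \<Longrightarrow> A \<in> shapes n \<Longrightarrow> surplus A = least_surplus n \<Longrightarrow> U \<subseteq> A \<Longrightarrow>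
      (\<And>x v. x \<in> U \<Longrightarrow> v \<in> directions \<Longrightarrow> x + v \<in> A \<Longrightarrow> x + v \<in> U) \<Longrightarrow>
      real (card U) < \<epsilon> * real n \<or> (1 - \<epsilon>) * real n < real (card U)"
      using separated_part_is_lopsided[OF eps(1)] by blast
    have "D1 n \<subseteq> D n \<and> (1 - \<epsilon>) * real n < real (card (D1 n))" if n: "max N 1 \<le> n" for n
    proof -
      have n1: "1 \<le> n" using n by simp
      obtain A where A: "A \<in> shapes n" "D n = site eS ` A" "surplus A = least_surplus n"
        using shape_of_minimizer[OF assms(1,3,4) sub assms(8) minimizer[OF n1]] .
      have "real (card U) < \<epsilon> * real n \<or> (1 - \<epsilon>) * real n < real (card U)"
        if U: "U \<subseteq> D n" "bonds (D n) `` U \<subseteq> U" for U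
      proof -
        obtain V where V: "V \<subseteq> A" "U = site eS ` V" using U(1) unfolding A(2) by (auto simp: subset_image_iff)
        have "x + v \<in> V" if x: "x \<in> V" "v \<in> directions" "x + v \<in> A" for x v
        proof -
          have "(site eS x, site eS (x + v)) \<in> bonds (D n)"
            using x V(1) by (auto simp: bonds_def A(2) dist_site_eq_1_iff)
          then have "site eS (x + v) \<in> site eS ` V" using U(2) V(2) x(1) by blast
          then show ?thesis using inj_site by (simp add: inj_image_mem_iff)
        qed
        then have "real (card V) < \<epsilon> * real n \<or> (1 - \<epsilon>) * real n < real (card V)"
          using N[OF _ A(1,3) V(1)] n by simp
        then show ?thesis
          using V(2) by (simp add: card_image inj_on_subset[OF inj_site])
      qed
      then show ?thesis
        using largest_component_dominates[OF D[OF n1] _ eps _ largest_component[OF n1]] n1 by auto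
    qed
    then show ?thesis by (intro exI[of _ "max N 1"]) auto
  qed
  have fraction: "(\<lambda>n. real (card (D1 n)) / real n) \<longlonglongrightarrow> 1"
  proof (rule LIMSEQ_I)
    fix r :: real assume r: "0 < r"
    define e where "e = min r (1 / 3)"
    have e: "0 < e" "e \<le> 1 / 3" "e \<le> r" using r by (auto simp: e_def)
    obtain N where N: "1 \<le> N" "\<And>n. N \<le> n \<Longrightarrow> D1 n \<subseteq> D n"
        "\<And>n. N \<le> n \<Longrightarrow> (1 - e) * real n < real (card (D1 n))"
      using eventually_large[OF e(1,2)] by blast
    have "norm (real (card (D1 n)) / real n - 1) < r" if n: "N \<le> n" for n
    proof -
      have "0 < n" using n N(1) by simp
      have "card (D1 n) \<le> n" using card_mono[OF D(1) N(2)] D(2) n N(1) by force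
      then have "real (card (D1 n)) / real n \<le> 1" using \<open>0 < n\<close> by simp
      moreover have "1 - e < real (card (D1 n)) / real n"
        using N(3)[OF n] \<open>0 < n\<close> by (simp add: pos_less_divide_eq)
      ultimately show ?thesis using e(3) r by (simp add: abs_less_iff)
    qed
    then show "\<exists>N. \<forall>n\<ge>N. norm (real (card (D1 n)) / real n - 1) < r" by blast
  qed
  obtain N where N: "1 \<le> N" "\<And>n. N \<le> n \<Longrightarrow> D1 n \<subseteq> D n"
    using eventually_large[of "1 / 3"] by auto
  have "\<forall>\<^sub>F n in sequentially. real (card (D1 n)) / real n
      = measure (empirical_measure (D n)) (rescale n ` D1 n)"
    using N D by (intro eventually_sequentiallyI[of N])
      (simp add: measure_empirical_measure_rescale)
  with fraction have "(\<lambda>n. measure (empirical_measure (D n)) (rescale n ` D1 n)) \<longlonglongrightarrow> 1"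
    by (rule Lim_transform_eventually)
  then show ?thesis using fraction ..
qed

end
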